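(* Let $A_{11},A_{12},A_{21},\mu$ be real numbers with $-A_{21}A_{12}=1+A_{11}+A_{11}^2$ and, by the sign normalization, $A_{21}<0<A_{12}$. Let the initial tableau be $$M^{(1)}=\begin{bmatrix} A_{11} & A_{12} & -(A_{11}+1) & -A_{12} & 1 & 0\\ A_{21} & -(A_{11}+1) & -A_{21} & A_{11} & 0 & 1\\ -1 & \mu & -(A_{11}+1)+\mu A_{21} & -A_{12}-\mu A_{11} & 0 & 0\end{bmatrix}$$ with zero right-hand sides and all variables initially zero. Let $\tau>0$ and $u\ge 0$ be the EXPAND parameters. Assume that the EXPAND row selection method is used and that the columns are selected in the 2/6-cycle order. Then cycling occurs (the 2/6-cycle pattern of pivots continues indefinitely) if and only if $$0<A_{11}\le\tfrac12\quad\text{and}\quad 0<A_{12}<1 .$$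
   Context: The linear program is: maximize $z=\sum_{j=1}^4c_jx_j$ subject to two constraints $\sum_{j=1}^4N_{ij}x_j\le0$ and $x_j\ge0$. Slack variables $x_5,x_6$ form the initial basis (rows 1 and 2 respectively), and the objective is written as the row $z-\sum_jc_jx_j=0$. $M^{(1)}$ is the matrix of coefficients of $x_1,\dots,x_6$ in the two constraint rows (rows 1, 2) and the objective row (row 3), and each iteration is a simplex (Gauss-Jordan) pivot. 2/6-cycle column order: in iteration $n=1,2,3,\dots$ the entering column is column $n$, with indices taken modulo 6 in $\{1,\dots,6\}$. The 2/6-cycle pattern of pivots is this column order together with the pivot being in row 1 in every odd iteration and in row 2 in every even iteration. EXPAND row selection: in iteration $n$ the feasibility tolerance is $\delta=\tau u^n$ where $u^n=u+n$ (the superscript is an index; the initial tolerance is $\tau u$). Let $p$ be the entering column of the current tableau, with entry $p_j$ in the row of the basic variable $x_j$. A step $\alpha$ increases the entering variable by $\alpha$ and changes each basic variable from $x_j$ to $x_j-\alpha p_j$; the other nonbasic variables are unchanged. - First pass: $\alpha^{\max}$ is the largest $\alpha$ such that $x_j-\alpha p_j\ge-\delta$ for all basic $j$, i.e. $\alpha^{\max}=\min_{p_j>0}(x_j+\delta)/p_j$. - Second pass: put $\alpha_j=x_j/p_j$ if $p_j>0$ and $\alpha_j=\infty$ otherwise. The leaving variable $x_r$ is the one with the largest $p_j$ among the basic $j$ with $\alpha_j\le\alpha^{\max}$ (if there is a tie, row 1 is chosen). - Step: $\alpha^{\rm full}=\alpha_r$, $\alpha^{\min}=\tau/p_r$, and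 the step taken is $\alpha=\max(\alpha^{\min},\alpha^{\rm full})$. The leaving variable becomes nonbasic at its resulting value $x_r-\alpha p_r$, which need not be zero. If no $p_j$ is positive, the method stops (unbounded). No resetting of the tolerance or of the variable values is performed. Sign normalization: the relation $-A_{21}A_{12}=1+A_{11}+A_{11}^2>0$ forces $A_{12}$ and $A_{21}$ to have opposite signs. The case $A_{21}>0$ corresponds to the case $A_{21}<0$ after shifting columns cyclically by one place and interchanging the two rows, so the convention $A_{21}<0<A_{12}$ is adopted. *)

theory Defs
  imports "HOL-Analysis.Analysis"
begin

(* Variables are indexed by the type 6, constraint and objective rows by the type 3.  Numerals in
   these types are taken modulo 6 and 3, so variable 6 is 0 :: 6 and the objective row 3 is
   0 :: 3. *)

definition constraint_rows :: "3 set" where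
  "constraint_rows = {1, 2}"

record simplex_state =
  tableau :: "real^6^3"
  basis :: "3 \<Rightarrow> 6"  (* basic variable of each constraint row; not used on the objective row *)
  val :: "real^6"  (* values of all variables; nonbasic ones need not be zero *)

definition pivot :: "real^6^3 \<Rightarrow> 3 \<Rightarrow> 6 \<Rightarrow> real^6^3" where
  "pivot T r q = (\<chi> i j. if i = r then T $ r $ j / T $ r $ q
                        else T $ i $ j - T $ i $ q * (T $ r $ j / T $ r $ q))"

definition basic_val :: "simplex_state \<Rightarrow> 3 \<Rightarrow> real" where
  "basic_val S i = val S $ basis S i"

definition positive_rows :: "simplex_state \<Rightarrow> 6 \<Rightarrow> 3 set" where
  "positive_rows S q = {i \<in> constraint_rows. tableau S $ i $ q > 0}"

(* First pass.  Used only if positive_rows S q is nonempty. *)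
definition alpha_max :: "real \<Rightarrow> simplex_state \<Rightarrow> 6 \<Rightarrow> real" where
  "alpha_max \<delta> S q =
     Min ((\<lambda>i. (basic_val S i + \<delta>) / tableau S $ i $ q) ` positive_rows S q)"

(* Second pass.  Rows with a nonpositive entry have infinite ratio, hence are never eligible. *)
definition eligible_rows :: "real \<Rightarrow> simplex_state \<Rightarrow> 6 \<Rightarrow> 3 set" where
  "eligible_rows \<delta> S q =
     {i \<in> positive_rows S q. basic_val S i / tableau S $ i $ q \<le> alpha_max \<delta> S q}"

(* None: no entry of the entering column is positive, and the method stops.  Ties go to row 1. *)
definition expand_row :: "real \<Rightarrow> simplex_state \<Rightarrow> 6 \<Rightarrow> 3 option" where
  "expand_row \<delta> S q =
     (if positive_rows S q = {} then None
      else if is_arg_max (\<lambda>i. tableau S $ i $ q) (\<lambda>i. i \<in> eligible_rows \<delta> S q) 1 then Some 1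
      else Some 2)"

definition expand_step_length :: "real \<Rightarrow> simplex_state \<Rightarrow> 6 \<Rightarrow> 3 \<Rightarrow> real" where
  "expand_step_length \<tau> S q r =
     max (\<tau> / tableau S $ r $ q) (basic_val S r / tableau S $ r $ q)"

definition move :: "simplex_state \<Rightarrow> 6 \<Rightarrow> real \<Rightarrow> real^6" where
  "move S q \<alpha> = (\<chi> j. if j = q then val S $ j + \<alpha>
     else if \<exists>i\<in>constraint_rows. basis S i = j
       then val S $ j - \<alpha> * tableau S $ (THE i. i \<in> constraint_rows \<and> basis S i = j) $ q
     else val S $ j)"

definition exchange :: "real \<Rightarrow> simplex_state \<Rightarrow> 6 \<Rightarrow> 3 \<Rightarrow> simplex_state" where
  "exchange \<tau> S q r =
     \<lparr> tableau = pivot (tableau S) r q,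
       basis = (basis S)(r := q),
       val = move S q (expand_step_length \<tau> S q r) \<rparr>"

definition cycle_column :: "nat \<Rightarrow> 6" where
  "cycle_column n = of_nat n"  (* reduction modulo 6, see above *)

definition cycle_row :: "nat \<Rightarrow> 3" where
  "cycle_row n = (if odd n then 1 else 2)"

definition tolerance :: "real \<Rightarrow> real \<Rightarrow> nat \<Rightarrow> real" where
  "tolerance \<tau> u n = \<tau> * (u + real n)"

definition iteration_row :: "real \<Rightarrow> real \<Rightarrow> nat \<Rightarrow> simplex_state \<Rightarrow> 3 option" where
  "iteration_row \<tau> u n S = expand_row (tolerance \<tau> u n) S (cycle_column n)"

(* expand_run tau u S k is the state after k iterations from S; None if the method has stopped. *)
primrec expand_run :: "real \<Rightarrow> real \<Rightarrow> simplex_state \<Rightarrow> nat \<Rightarrow> simplex_state option" where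
  "expand_run \<tau> u S 0 = Some S"
| "expand_run \<tau> u S (Suc k) =
     Option.bind (expand_run \<tau> u S k) (\<lambda>S'.
       map_option (exchange \<tau> S' (cycle_column (Suc k))) (iteration_row \<tau> u (Suc k) S'))"

definition cycles_2_6 :: "real \<Rightarrow> real \<Rightarrow> simplex_state \<Rightarrow> bool" where
  "cycles_2_6 \<tau> u S \<longleftrightarrow>
     (\<forall>n\<ge>1. Option.bind (expand_run \<tau> u S (n - 1)) (iteration_row \<tau> u n) = Some (cycle_row n))"

definition initial_tableau :: "real \<Rightarrow> real \<Rightarrow> real \<Rightarrow> real \<Rightarrow> real^6^3" where
  "initial_tableau A11 A12 A21 \<mu> = vector [
     vector [A11, A12, - (A11 + 1), - A12, 1, 0],
     vector [A21, - (A11 + 1), - A21, A11, 0, 1],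
     vector [- 1, \<mu>, - (A11 + 1) + \<mu> * A21, - A12 - \<mu> * A11, 0, 0]]"

definition initial_state :: "real \<Rightarrow> real \<Rightarrow> real \<Rightarrow> real \<Rightarrow> simplex_state" where
  "initial_state A11 A12 A21 \<mu> =
     \<lparr> tableau = initial_tableau A11 A12 A21 \<mu>,
       basis = (\<lambda>i. if i = 1 then 5 else 6),
       val = 0 \<rparr>"

end

theory Submission
  imports Defs
begin

text \<open>As \<open>A21 < 0\<close>, row 1 is chosen in odd iterations if and only if \<open>A11 > 0\<close>; the values of the
  variables play no role there. In even iterations both entries are positive, in the ratio
  \<open>A12 : 1\<close>, and row 1 is always eligible, so that row 2 is chosen if and only if \<open>A12 < 1\<close> and
  row 2 is eligible. Odd iterations only take the minimal step, and eligibility of row 2 says that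
  the value of the variable about to leave row 1 in the next iteration is at least the negative
  tolerance. Over six iterations the tolerance grows by \<open>6 \<tau>\<close>, whereas for \<open>A11 < 1\<close> that value
  falls by asymptotically \<open>3 \<tau> / (1 - A11)\<close>, which is at most \<open>6 \<tau>\<close> if and only if
  \<open>A11 \<le> 1 / 2\<close>.\<close>

section \<open>One EXPAND iteration on two constraint rows\<close>

lemma expand_row_nonpositive:
  assumes "tableau S $ 1 $ q \<le> 0" and "tableau S $ 2 $ q \<le> 0"
  shows "expand_row \<delta> S q = None"
  using assms by (auto simp: expand_row_def positive_rows_def constraint_rows_def)

lemma expand_row_single_positive:
  assumes "tableau S $ 1 $ q > 0" and "tableau S $ 2 $ q \<le> 0" and "\<delta> \<ge> 0"
  shows "expand_row \<delta> S q = Some 1"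
proof -
  have pos: "positive_rows S q = {1}"
    using assms by (auto simp: positive_rows_def constraint_rows_def)
  have "eligible_rows \<delta> S q = {1}"
    using assms by (auto simp: eligible_rows_def alpha_max_def pos divide_right_mono)
  then show ?thesis
    by (simp add: expand_row_def pos is_arg_max_linorder)
qed

text \<open>Each row passes its own first-pass bound since \<open>\<delta> \<ge> 0\<close>, and
  \<open>x1\<close> makes row 1 pass that of row 2. Only the bound of row 1 on row 2 remains; ties
  go to row 1, hence the strict inequality.\<close>

lemma expand_row_both_positive:
  assumes p1: "tableau S $ 1 $ q > 0" and p2: "tableau S $ 2 $ q > 0" and "\<delta> \<ge> 0"
    and x1: "basic_val S 1 / tableau S $ 1 $ q \<le> (basic_val S 2 + \<delta>) / tableau S $ 2 $ q"
  shows "expand_row \<delta> S q = Some 2 \<longleftrightarrow>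
    tableau S $ 1 $ q < tableau S $ 2 $ q \<and>
    basic_val S 2 / tableau S $ 2 $ q \<le> (basic_val S 1 + \<delta>) / tableau S $ 1 $ q"
proof -
  have pos: "positive_rows S q = {1, 2}"
    using p1 p2 by (auto simp: positive_rows_def constraint_rows_def)
  have self: "basic_val S i / tableau S $ i $ q \<le> (basic_val S i + \<delta>) / tableau S $ i $ q"
    if "tableau S $ i $ q > 0" for i
    using that \<open>\<delta> \<ge> 0\<close> by (simp add: divide_right_mono)
  have el: "i \<in> eligible_rows \<delta> S q \<longleftrightarrow> i = 1 \<or> i = 2 \<and>
      basic_val S 2 / tableau S $ 2 $ q \<le> (basic_val S 1 + \<delta>) / tableau S $ 1 $ q" for i
    using self[OF p1] self[OF p2] x1
    by (auto simp: eligible_rows_def alpha_max_def pos)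
  show ?thesis
    by (auto simp: expand_row_def pos is_arg_max_linorder el not_le)
qed

lemma val_exchange:
  assumes "basis S 1 = j1" and "basis S 2 = j2" and "j1 \<noteq> j2" and "j1 \<noteq> q" and "j2 \<noteq> q"
  shows "val (exchange \<tau> S q r) $ q = val S $ q + expand_step_length \<tau> S q r"
    and "val (exchange \<tau> S q r) $ j1 =
      val S $ j1 - expand_step_length \<tau> S q r * tableau S $ 1 $ q"
    and "val (exchange \<tau> S q r) $ j2 =
      val S $ j2 - expand_step_length \<tau> S q r * tableau S $ 2 $ q"
    and "j \<noteq> q \<Longrightarrow> j \<noteq> j1 \<Longrightarrow> j \<noteq> j2 \<Longrightarrow> val (exchange \<tau> S q r) $ j = val S $ j"
proof -
  have "(THE i. i \<in> constraint_rows \<and> basis S i = j1) = 1"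
    "(THE i. i \<in> constraint_rows \<and> basis S i = j2) = 2"
    using assms by (auto simp: constraint_rows_def intro!: the_equality)
  then show "val (exchange \<tau> S q r) $ q = val S $ q + expand_step_length \<tau> S q r"
    and "val (exchange \<tau> S q r) $ j1 =
      val S $ j1 - expand_step_length \<tau> S q r * tableau S $ 1 $ q"
    and "val (exchange \<tau> S q r) $ j2 =
      val S $ j2 - expand_step_length \<tau> S q r * tableau S $ 2 $ q"
    and "j \<noteq> q \<Longrightarrow> j \<noteq> j1 \<Longrightarrow> j \<noteq> j2 \<Longrightarrow> val (exchange \<tau> S q r) $ j = val S $ j"
    using assms by (auto simp: exchange_def move_def constraint_rows_def)
qed

lemma expand_step_length_positive:
  assumes "tableau S $ r $ q > 0"
  shows "basic_val S r \<le> \<tau> \<Longrightarrow> expand_step_length \<tau> S q r = \<tau> / tableau S $ r $ q"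
    and "\<tau> \<le> basic_val S r \<Longrightarrow>
      expand_step_length \<tau> S q r = basic_val S r / tableau S $ r $ q"
  using assms by (simp_all add: expand_step_length_def divide_right_mono max_absorb1 max_absorb2)

lemma tableau_exchange:
  "tableau (exchange \<tau> S q r) $ i $ j =
     (if i = r then tableau S $ r $ j / tableau S $ r $ q
      else tableau S $ i $ j - tableau S $ i $ q * (tableau S $ r $ j / tableau S $ r $ q))"
  by (simp add: exchange_def pivot_def)

lemma basis_exchange: "basis (exchange \<tau> S q r) = (basis S)(r := q)"
  by (simp add: exchange_def)

section \<open>The value sequences of the 2/6-cycle\<close>

text \<open>In units of \<open>\<tau> / A12\<close>, \<open>even_level A11 k\<close> (for \<open>k > 0\<close>) is the step length of iteration \<open>2 k\<close>
  divided by \<open>A11\<close>.\<close>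

primrec even_level :: "real \<Rightarrow> nat \<Rightarrow> real" where
  "even_level a 0 = 0"
| "even_level a (Suc k) = a * even_level a k + (1 + a + a\<^sup>2) / a"

text \<open>In units of \<open>\<tau>\<close>, \<open>odd_level A11 k\<close> is the nonbasic value with which the column of iteration
  \<open>2 k + 1\<close> enters; it left the basis in iteration \<open>2 k - 3\<close>.\<close>

fun odd_level :: "real \<Rightarrow> nat \<Rightarrow> real" where
  "odd_level a 0 = 0"
| "odd_level a (Suc 0) = 0"
| "odd_level a (Suc (Suc 0)) = - 1"
| "odd_level a (Suc (Suc (Suc k))) = odd_level a k + 1 / a - 1 - even_level a (Suc k)"

section \<open>Signs and monotonicity of the two sequences\<close>

lemma even_level_nonneg: "a > 0 \<Longrightarrow> even_level a k \<ge> 0"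
  by (induction k) auto

text \<open>By this bound \<open>odd_level\<close> falls by at least 2 over three indices.\<close>

lemma even_level_Suc_ge: "a > 0 \<Longrightarrow> even_level a (Suc k) \<ge> 1 / a + 1"
  using even_level_nonneg[of a k] mult_nonneg_nonneg[of a "even_level a k"]
  by (simp add: field_simps power2_eq_square)

lemma odd_level_nonpos:
  assumes "a > 0"
  shows "odd_level a k \<le> 0"
  using assms
proof (induction a k rule: odd_level.induct)
  case (4 a k)
  then show ?case using even_level_Suc_ge[of a k] by (simp del: even_level.simps)
qed auto

lemma even_level_mono:
  assumes "a > 0"
  shows "mono (even_level a)"
proof -
  have "even_level a k \<le> even_level a (Suc k)" for k
  proof (induction k)
    case 0
    then show ?case using even_level_nonneg[OF assms, of "Suc 0"] by simp
  next
    case (Suc k)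
    then show ?case using assms by simp
  qed
  then show ?thesis by (simp add: incseq_SucI)
qed

section \<open>Bounds for \<open>a \<le> 1 / 2\<close>\<close>

lemma even_level_le:
  assumes "0 < a" and "a \<le> 1 / 2"
  shows "even_level a k \<le> 5 + 1 / a"
proof (induction k)
  case 0
  then show ?case using assms by simp
next
  case (Suc k)
  \<comment> \<open>When \<open>even_level\<close> equals \<open>5 + 1 / a\<close>,
    \<open>odd_level\<close> drops by exactly 6 over three indices, that is, six iterations. The
    recursion maps this threshold to at most itself precisely for
    \<open>a \<le> 1 / 2\<close>.\<close>
  have "even_level a (Suc k) \<le> a * (5 + 1 / a) + (1 + a + a\<^sup>2) / a"
    using Suc assms by simp
  also have "\<dots> = 6 * a + 2 + 1 / a"
    using assms by (simp add: field_simps power2_eq_square)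
  also have "\<dots> \<le> 5 + 1 / a" using assms by simp
  finally show ?case .
qed

text \<open>This is the eligibility condition of row 2 with \<open>u = 0\<close>. Over three indices
  the bound falls by 6 and \<open>odd_level\<close> by at most 6, so three starting indices remain
  to be checked.\<close>

lemma odd_level_ge:
  assumes a: "0 < a" "a \<le> 1 / 2"
  shows "odd_level a (k + 3) \<ge> - (2 * real k + 3)"
proof (induction k rule: less_induct)
  case (less k)
  have sq: "a\<^sup>2 \<le> 1 / 4" using power_mono[of a "1/2" 2] a by (simp add: power2_eq_square)
  have drop: "odd_level a (j + 3) \<ge> odd_level a j - 6" for j
    using even_level_le[OF a, of "Suc j"] by (simp add: numeral_3_eq_3 del: even_level.simps)
  consider "k = 0" | "k = 1" | "k = 2" | j where "k = j + 3"
  proof -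
    have "k = 0 \<or> k = 1 \<or> k = 2 \<or> (\<exists>j. k = j + 3)" by presburger
    then show thesis using that by blast
  qed
  then show ?case
  proof cases
    case 1
    then show ?thesis using a by (simp add: numeral_3_eq_3 field_simps power2_eq_square)
  next
    case 2
    have "odd_level a 4 = - (3 + 2 * a + a\<^sup>2)"
      using a by (simp add: eval_nat_numeral field_simps power2_eq_square)
    then show ?thesis using a sq 2 by simp
  next
    case 3
    then show ?thesis using drop[of 2] by (simp add: numeral_2_eq_2)
  next
    case (4 j)
    then show ?thesis using drop[of "j + 3"] less[of j] by simp
  qed
qed

section \<open>Failure for \<open>a > 1 / 2\<close>\<close>

lemma even_level_exceeds:
  assumes "a > 1 / 2"
  shows "\<exists>k. even_level a k > 5 + 1 / a"
proof (rule ccontr)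
  assume "\<not> ?thesis"
  then have le: "even_level a k \<le> 5 + 1 / a" for k by (simp add: not_less)
  \<comment> \<open>Below the threshold each step gains at least \<open>e\<close>: for
    \<open>a < 1\<close> the gain is least at the threshold, where it is \<open>6 * a - 3\<close>;
    for \<open>a \<ge> 1\<close> it is at least 3 because
    \<open>(a - 1)\<^sup>2 \<ge> 0\<close>.\<close>
  define e where "e = min 3 (6 * a - 3)"
  have "e > 0" using assms by (simp add: e_def)
  have step: "even_level a (Suc k) \<ge> even_level a k + e" for k
  proof (cases "a \<ge> 1")
    case True
    have "(1 + a + a\<^sup>2) / a \<ge> 3"
      using True zero_le_power2[of "a - 1"] by (simp add: field_simps power2_eq_square)
    moreover have "a * even_level a k \<ge> even_level a k"
      using True even_level_nonneg[of a k] mult_right_mono[of 1 a "even_level a k"] by simp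
    ultimately show ?thesis by (simp add: e_def)
  next
    case False
    have "(1 - a) * even_level a k \<le> (1 - a) * (5 + 1 / a)"
      using False le[of k] by (intro mult_left_mono) auto
    also have "\<dots> = (1 + a + a\<^sup>2) / a - (6 * a - 3)"
      using assms by (simp add: field_simps power2_eq_square)
    finally show ?thesis by (simp add: e_def algebra_simps)
  qed
  have "even_level a k \<ge> real k * e" for k
  proof (induction k)
    case (Suc k)
    then show ?case using step[of k] by (simp add: algebra_simps del: even_level.simps(2))
  qed simp
  then have "real k * e \<le> 5 + 1 / a" for k using le[of k] order_trans by blast
  moreover obtain k where "real k * e > 5 + 1 / a" using reals_Archimedean3[OF \<open>e > 0\<close>] by blast
  ultimately show False by (meson not_less)
qed

text \<open>Once \<open>even_level\<close> exceeds the threshold, monotonicity preserves the excess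
  \<open>e\<close>, so \<open>odd_level\<close> loses at least \<open>6 + e\<close> per three
  indices. No constant \<open>C\<close> makes up for that.\<close>

lemma odd_level_bounded_decrease:
  assumes "0 < a" and C: "\<And>k. odd_level a (k + 3) \<ge> - C - 2 * real k"
  shows "a \<le> 1 / 2"
proof (rule ccontr)
  assume "\<not> a \<le> 1 / 2"
  then obtain K where K: "even_level a K > 5 + 1 / a" using even_level_exceeds[of a] by auto
  define e where "e = even_level a K - 5 - 1 / a"
  have "e > 0" using K by (simp add: e_def)
  have drop: "odd_level a (n + 3) \<le> odd_level a n - 6 - e" if "n \<ge> K" for n
    using monoD[OF even_level_mono[OF \<open>0 < a\<close>], of K "Suc n"] that
    by (simp add: numeral_3_eq_3 e_def del: even_level.simps)
  have "odd_level a (K + 3 * j) \<le> odd_level a K - real j * (6 + e)" for j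
  proof (induction j)
    case (Suc j)
    then show ?case using drop[of "K + 3 * j"]
      by (simp add: algebra_simps numeral_3_eq_3 del: odd_level.simps)
  qed simp
  from this[of "Suc j" for j]
  have "odd_level a (K + 3 * j + 3) \<le> odd_level a K - real (Suc j) * (6 + e)" for j
    by (simp add: ac_simps del: odd_level.simps)
  with C have "- C - 2 * real (K + 3 * j) \<le> odd_level a K - real (Suc j) * (6 + e)" for j
    by (rule order_trans)
  then have "real j * e \<le> odd_level a K + C + 2 * real K" for j
    using \<open>e > 0\<close> by (auto simp: algebra_simps dest: meta_spec[of _ j])
  moreover obtain j where "real j * e > odd_level a K + C + 2 * real K"
    using reals_Archimedean3[OF \<open>e > 0\<close>] by blast
  ultimately show False by (meson not_less)
qed

section \<open>The run along the 2/6-cycle\<close>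

text \<open>Here \<open>a\<close>, \<open>b\<close>, \<open>c\<close> are \<open>A11\<close>,
  \<open>A12\<close>, \<open>A21\<close>, in the case \<open>A11 > 0\<close>.\<close>

locale normalized_cycle =
  fixes a b c \<tau> u :: real
  assumes det: "- c * b = 1 + a + a\<^sup>2"
    and b_pos: "0 < b" and a_pos: "0 < a" and tau_pos: "0 < \<tau>" and u_nonneg: "0 \<le> u"
begin

lemma c_eq: "c = - (1 + a + a\<^sup>2) / b"
  using det b_pos by (simp add: field_simps)

lemma quad_pos: "1 + a + a\<^sup>2 > 0"
  using a_pos by (simp add: add_pos_pos)

text \<open>The first two columns of the constraint rows form a matrix \<open>A\<close> with \<open>A\<^sup>2 + A + I = 0\<close>, and
  the six columns are \<open>[A, A\<^sup>2, A\<^sup>3]\<close>. Two pivots multiply by \<open>A\<close> inverted, which shifts the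
  columns by two places.\<close>

definition before_odd :: "nat \<Rightarrow> simplex_state \<Rightarrow> bool" where
  "before_odd k S \<longleftrightarrow> (let q = of_nat (2 * k); T = tableau S in
     basis S 1 = q + 5 \<and> basis S 2 = q \<and>
     T $ 1 $ (q + 1) = a \<and> T $ 1 $ (q + 2) = b \<and> T $ 1 $ (q + 3) = - (a + 1) \<and>
     T $ 1 $ (q + 4) = - b \<and> T $ 1 $ (q + 5) = 1 \<and> T $ 1 $ q = 0 \<and>
     T $ 2 $ (q + 1) = c \<and> T $ 2 $ (q + 2) = - (a + 1) \<and> T $ 2 $ (q + 3) = - c \<and>
     T $ 2 $ (q + 4) = a \<and> T $ 2 $ (q + 5) = 0 \<and> T $ 2 $ q = 1 \<and>
     val S $ (q + 1) = \<tau> * odd_level a k \<and> val S $ (q + 2) = 0 \<and>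
     val S $ (q + 3) = \<tau> * odd_level a (k + 1) \<and> val S $ (q + 4) = 0 \<and>
     val S $ (q + 5) = \<tau> * (odd_level a (k + 2) + 1) \<and>
     val S $ q = \<tau> * (a * even_level a k / b))"

text \<open>The odd step \<open>\<tau> / a\<close> lowers the leaving variable by
  \<open>\<tau>\<close> and raises the basic variable of row 2 by \<open>- c * \<tau> / a\<close>,
  the source of the constant term of \<open>even_level\<close>.\<close>

definition before_even :: "nat \<Rightarrow> simplex_state \<Rightarrow> bool" where
  "before_even k S \<longleftrightarrow> (let q = of_nat (2 * k); T = tableau S in
     basis S 1 = q + 1 \<and> basis S 2 = q \<and>
     T $ 1 $ (q + 1) = 1 \<and> T $ 1 $ (q + 2) = b / a \<and> T $ 1 $ (q + 3) = - (a + 1) / a \<and>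
     T $ 1 $ (q + 4) = - b / a \<and> T $ 1 $ (q + 5) = 1 / a \<and> T $ 1 $ q = 0 \<and>
     T $ 2 $ (q + 1) = 0 \<and> T $ 2 $ (q + 2) = 1 / a \<and> T $ 2 $ (q + 3) = c / a \<and>
     T $ 2 $ (q + 4) = - (a + 1) / a \<and> T $ 2 $ (q + 5) = - c / a \<and> T $ 2 $ q = 1 \<and>
     val S $ (q + 1) = \<tau> * (odd_level a k + 1 / a) \<and> val S $ (q + 2) = 0 \<and>
     val S $ (q + 3) = \<tau> * odd_level a (k + 1) \<and> val S $ (q + 4) = 0 \<and>
     val S $ (q + 5) = \<tau> * odd_level a (k + 2) \<and>
     val S $ q = \<tau> * (even_level a (Suc k) / b))"

text \<open>A full step in row 2 takes the row 1 variable to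
  \<open>\<tau> * (odd_level a (k + 3) + 1)\<close>, to be compared with minus the tolerance of
  iteration \<open>2 * k + 2\<close>.\<close>

definition even_ok :: "nat \<Rightarrow> bool" where
  "even_ok k \<longleftrightarrow> b < 1 \<and> odd_level a (k + 3) + u + 2 * real k + 3 \<ge> 0"

text \<open>The value \<open>- 1\<close> of \<open>odd_level\<close> at index 2 reflects that
  variable 5 starts at 0 and leaves at \<open>- \<tau>\<close>.\<close>

lemma before_odd_initial: "before_odd 0 (initial_state a b c \<mu>)"
  by (simp add: before_odd_def initial_state_def initial_tableau_def vector_def numeral_2_eq_2)

lemma iteration_row_odd:
  assumes "before_odd k S"
  shows "iteration_row \<tau> u (2 * k + 1) S = Some 1"
proof -
  have "c \<le> 0" using c_eq quad_pos b_pos by (simp add: divide_nonpos_pos)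
  then show ?thesis unfolding iteration_row_def
    using assms a_pos tau_pos u_nonneg
    by (intro expand_row_single_positive)
      (auto simp: before_odd_def Let_def cycle_column_def tolerance_def add.commute)
qed

lemma before_even_exchange:
  assumes "before_odd k S"
  shows "before_even k (exchange \<tau> S (cycle_column (2 * k + 1)) 1)"
proof -
  define q where "q = (of_nat (2 * k) :: 6)"
  have col: "cycle_column (2 * k + 1) = q + 1"
    by (simp add: q_def cycle_column_def add.commute)
  note inv = assms[unfolded before_odd_def Let_def, folded q_def]
  \<comment> \<open>The leaving variable is at most \<open>\<tau>\<close>, so the minimal step is
    taken.\<close>
  have "odd_level a (k + 2) + 1 \<le> 1" using odd_level_nonpos[OF a_pos, of "k + 2"] by simp
  then have "\<tau> * (odd_level a (k + 2) + 1) \<le> \<tau> * 1"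
    using tau_pos by (intro mult_left_mono) auto
  then have step: "expand_step_length \<tau> S (q + 1) 1 = \<tau> / a"
    using expand_step_length_positive(1)[of S 1 "q + 1" \<tau>] inv a_pos
    by (simp add: basic_val_def)
  note v = val_exchange[where S = S and ?j1.0 = "q + 5" and ?j2.0 = q and q = "q + 1" and \<tau> = \<tau> and r = 1]
  show ?thesis
    unfolding before_even_def Let_def col q_def[symmetric]
    using inv a_pos b_pos
    by (simp add: v step basis_exchange tableau_exchange c_eq)
      (simp add: field_simps power2_eq_square)
qed

lemma before_odd_exchange:
  assumes "before_even k S" and "b < 1"
  shows "before_odd (Suc k) (exchange \<tau> S (cycle_column (2 * k + 2)) 2)"
proof -
  define q where "q = (of_nat (2 * k) :: 6)"
  have col: "cycle_column (2 * k + 2) = q + 2" and q': "of_nat (2 * Suc k) = q + 2"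
    by (simp_all add: q_def cycle_column_def add.commute)
  note inv = assms(1)[unfolded before_even_def Let_def, folded q_def]
  \<comment> \<open>As \<open>1 / a + 1 > 1 > b\<close>, the leaving variable is at least
    \<open>\<tau>\<close>; the step is full and it leaves at zero.\<close>
  have "even_level a (Suc k) \<ge> b"
    using even_level_Suc_ge[OF a_pos, of k] a_pos \<open>b < 1\<close>
    by (smt (verit) divide_nonneg_nonneg)
  then have "\<tau> * 1 \<le> \<tau> * (even_level a (Suc k) / b)"
    using tau_pos b_pos by (intro mult_left_mono) auto
  then have step: "expand_step_length \<tau> S (q + 2) 2 = \<tau> * (a * even_level a (Suc k) / b)"
    using expand_step_length_positive(2)[of S 2 "q + 2" \<tau>] inv a_pos
    by (simp add: basic_val_def mult_ac del: even_level.simps)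
  have wrap: "q + 6 = q" "q + 7 = q + 1" by simp_all
  note v = val_exchange[where S = S and ?j1.0 = "q + 1" and ?j2.0 = q and q = "q + 2" and \<tau> = \<tau> and r = 2]
  show ?thesis
    unfolding before_odd_def Let_def col q'
    using inv a_pos b_pos
    by (simp add: v step basis_exchange tableau_exchange c_eq add.assoc wrap numeral_3_eq_3
        del: even_level.simps)
      (simp add: field_simps power2_eq_square del: even_level.simps)
qed

lemma iteration_row_even:
  assumes "before_even k S"
  shows "iteration_row \<tau> u (2 * k + 2) S = Some 2 \<longleftrightarrow> even_ok k"
proof -
  define q where "q = (of_nat (2 * k) :: 6)"
  have col: "cycle_column (2 * k + 2) = q + 2"
    by (simp add: q_def cycle_column_def add.commute)
  note inv = assms[unfolded before_even_def Let_def, folded q_def]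
  have x: "basic_val S 1 = \<tau> * (odd_level a k + 1 / a)"
    "basic_val S 2 = \<tau> * (even_level a (Suc k) / b)"
    and p: "tableau S $ 1 $ (q + 2) = b / a" "tableau S $ 2 $ (q + 2) = 1 / a"
    using inv by (simp_all add: basic_val_def del: even_level.simps)
  define \<delta> where "\<delta> = tolerance \<tau> u (2 * k + 2)"
  have delta: "\<delta> = \<tau> * (u + 2 * real k + 2)" by (simp add: \<delta>_def tolerance_def)
  have "\<delta> \<ge> 0" using tau_pos u_nonneg by (simp add: delta)
  \<comment> \<open>This makes row 1 eligible whatever the nonnegative tolerance.\<close>
  have "odd_level a k + 1 / a \<le> even_level a (Suc k)"
    using odd_level_nonpos[OF a_pos, of k] even_level_Suc_ge[OF a_pos, of k] by linarith
  then have "\<tau> * (odd_level a k + 1 / a) \<le> \<tau> * even_level a (Suc k)"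
    using tau_pos by simp
  then have "\<tau> * (odd_level a k + 1 / a) \<le> \<tau> * even_level a (Suc k) + b * \<delta>"
    using b_pos \<open>\<delta> \<ge> 0\<close> by (smt (verit) mult_nonneg_nonneg)
  then have le: "a / b * (\<tau> * (odd_level a k + 1 / a))
      \<le> a / b * (\<tau> * even_level a (Suc k) + b * \<delta>)"
    using a_pos b_pos by (intro mult_left_mono) auto
  have ratio: "basic_val S 1 / tableau S $ 1 $ (q + 2) = a / b * (\<tau> * (odd_level a k + 1 / a))"
    "basic_val S 2 / tableau S $ 2 $ (q + 2) = a / b * (\<tau> * even_level a (Suc k))"
    "(basic_val S 1 + \<delta>) / tableau S $ 1 $ (q + 2)
      = a / b * (\<tau> * (odd_level a k + 1 / a) + \<delta>)"
    "(basic_val S 2 + \<delta>) / tableau S $ 2 $ (q + 2)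
      = a / b * (\<tau> * even_level a (Suc k) + b * \<delta>)"
    unfolding x p using a_pos b_pos by (simp_all add: field_simps del: even_level.simps)
  have row1: "basic_val S 1 / tableau S $ 1 $ (q + 2)
      \<le> (basic_val S 2 + \<delta>) / tableau S $ 2 $ (q + 2)"
    unfolding ratio by (rule le)
  have "basic_val S 2 / tableau S $ 2 $ (q + 2) \<le> (basic_val S 1 + \<delta>) / tableau S $ 1 $ (q + 2)
      \<longleftrightarrow> \<tau> * even_level a (Suc k) \<le> \<tau> * (odd_level a k + 1 / a) + \<delta>"
    unfolding ratio using a_pos b_pos by (intro mult_le_cancel_left_pos) simp
  also have "\<dots> \<longleftrightarrow> \<tau> * even_level a (Suc k) \<le> \<tau> * (odd_level a k + 1 / a + u + 2 * real k + 2)"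
    by (simp add: delta algebra_simps del: even_level.simps)
  \<comment> \<open>The recursion of \<open>odd_level\<close> absorbs the \<open>even_level\<close>
    term.\<close>
  also have "\<dots> \<longleftrightarrow> odd_level a (k + 3) + u + 2 * real k + 3 \<ge> 0"
    using tau_pos by (auto simp: numeral_3_eq_3 simp del: even_level.simps)
  finally have row2: "basic_val S 2 / tableau S $ 2 $ (q + 2)
      \<le> (basic_val S 1 + \<delta>) / tableau S $ 1 $ (q + 2)
      \<longleftrightarrow> odd_level a (k + 3) + u + 2 * real k + 3 \<ge> 0" .
  have "expand_row \<delta> S (q + 2) = Some 2 \<longleftrightarrow>
      b / a < 1 / a \<and> odd_level a (k + 3) + u + 2 * real k + 3 \<ge> 0"
    using expand_row_both_positive[OF _ _ \<open>\<delta> \<ge> 0\<close> row1] row2 a_pos b_pos by (simp add: p)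
  then show ?thesis
    unfolding iteration_row_def col even_ok_def \<delta>_def[symmetric]
    using a_pos by (simp add: divide_less_cancel)
qed

section \<open>From single iterations to the whole run\<close>

lemma expand_run_odd:
  assumes "expand_run \<tau> u S0 (2 * k) = Some S" and "before_odd k S"
  shows "\<exists>S'. expand_run \<tau> u S0 (2 * k + 1) = Some S' \<and> before_even k S'"
  using assms iteration_row_odd[of k S] before_even_exchange[of k S] by simp

lemma expand_run_even:
  assumes "before_odd 0 S0" and "\<And>j. j < k \<Longrightarrow> even_ok j"
  shows "\<exists>S. expand_run \<tau> u S0 (2 * k) = Some S \<and> before_odd k S"
  using assms(2)
proof (induction k)
  case 0
  then show ?case using assms(1) by simp
next
  case (Suc k)
  then obtain S where "expand_run \<tau> u S0 (2 * k) = Some S" "before_odd k S" by auto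
  then obtain S' where S': "expand_run \<tau> u S0 (2 * k + 1) = Some S'" "before_even k S'"
    using expand_run_odd by blast
  have "even_ok k" using Suc.prems by simp
  then have "iteration_row \<tau> u (2 * k + 2) S' = Some 2" "b < 1"
    using iteration_row_even[OF S'(2)] by (simp_all add: even_ok_def)
  then show ?case using S' before_odd_exchange[OF S'(2)] by simp
qed

lemma cycles_iff_even_ok:
  assumes init: "before_odd 0 S0"
  shows "cycles_2_6 \<tau> u S0 \<longleftrightarrow> (\<forall>k. even_ok k)"
proof
  assume cyc: "cycles_2_6 \<tau> u S0"
  have "even_ok k" for k
  \<comment> \<open>Strong induction: \<open>even_ok\<close> at all earlier indices is what carries
    the invariant up to iteration \<open>2 * k + 2\<close>.\<close>
  proof (induction k rule: less_induct)
    case (less k)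
    obtain S' where S': "expand_run \<tau> u S0 (2 * k + 1) = Some S'" "before_even k S'"
      using expand_run_even[OF init less] expand_run_odd by blast
    have "Option.bind (expand_run \<tau> u S0 (2 * k + 2 - 1)) (iteration_row \<tau> u (2 * k + 2))
        = Some (cycle_row (2 * k + 2))"
      using cyc unfolding cycles_2_6_def by (rule allE[of _ "2 * k + 2"]) simp
    moreover have "2 * k + 2 - 1 = 2 * k + 1" by simp
    ultimately have "iteration_row \<tau> u (2 * k + 2) S' = Some 2"
      using S'(1) by (simp add: cycle_row_def del: expand_run.simps)
    then show ?case using iteration_row_even[OF S'(2)] by simp
  qed
  then show "\<forall>k. even_ok k" ..
next
  assume ok: "\<forall>k. even_ok k"
  show "cycles_2_6 \<tau> u S0"
    unfolding cycles_2_6_def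
  proof (intro allI impI)
    fix n :: nat
    assume "n \<ge> 1"
    define k where "k = (n - 1) div 2"
    have n: "n = 2 * k + 1 \<or> n = 2 * k + 2" using \<open>n \<ge> 1\<close> unfolding k_def by presburger
    obtain S where S: "expand_run \<tau> u S0 (2 * k) = Some S" "before_odd k S"
      using expand_run_even[OF init, of k] ok by blast
    obtain S' where S': "expand_run \<tau> u S0 (2 * k + 1) = Some S'" "before_even k S'"
      using expand_run_odd[OF S] by blast
    from n show "Option.bind (expand_run \<tau> u S0 (n - 1)) (iteration_row \<tau> u n) = Some (cycle_row n)"
    proof
      assume "n = 2 * k + 1"
      then show ?thesis using S iteration_row_odd by (simp add: cycle_row_def)
    next
      assume "n = 2 * k + 2"
      moreover from this have "n - 1 = 2 * k + 1" by simp
      ultimately show ?thesis using S' iteration_row_even ok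
        by (simp add: cycle_row_def del: expand_run.simps)
    qed
  qed
qed

lemma even_ok_iff: "(\<forall>k. even_ok k) \<longleftrightarrow> a \<le> 1 / 2 \<and> b < 1"
proof
  assume ok: "\<forall>k. even_ok k"
  then have "odd_level a (k + 3) \<ge> - (u + 3) - 2 * real k" for k
    by (auto simp: even_ok_def algebra_simps dest: spec[of _ k])
  from odd_level_bounded_decrease[OF a_pos this] show "a \<le> 1 / 2 \<and> b < 1"
    using ok by (simp add: even_ok_def)
next
  assume "a \<le> 1 / 2 \<and> b < 1"
  then show "\<forall>k. even_ok k"
    using odd_level_ge[OF a_pos] u_nonneg unfolding even_ok_def by (smt (verit))
qed

end

theorem proposition4:
  fixes A11 A12 A21 \<mu> \<tau> u :: real
  assumes "- A21 * A12 = 1 + A11 + A11\<^sup>2"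
    and "A21 < 0" and "0 < A12"
    and "\<tau> > 0" and "u \<ge> 0"
  shows "cycles_2_6 \<tau> u (initial_state A11 A12 A21 \<mu>) \<longleftrightarrow>
           (0 < A11 \<and> A11 \<le> 1/2) \<and> (0 < A12 \<and> A12 < 1)"
proof (cases "A11 > 0")
  case True
  then interpret normalized_cycle A11 A12 A21 \<tau> u
    using assms by unfold_locales auto
  show ?thesis
    using cycles_iff_even_ok[OF before_odd_initial] even_ok_iff True \<open>0 < A12\<close> by simp
next
  case False
  \<comment> \<open>Both constraint entries of column 1, \<open>A11\<close> and \<open>A21\<close>,
    are nonpositive, so the method stops at once.\<close>
  then have "iteration_row \<tau> u 1 (initial_state A11 A12 A21 \<mu>) = None"
    using \<open>A21 < 0\<close> unfolding iteration_row_def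
    by (intro expand_row_nonpositive)
      (simp_all add: cycle_column_def initial_state_def initial_tableau_def vector_def)
  then have "\<not> cycles_2_6 \<tau> u (initial_state A11 A12 A21 \<mu>)"
    by (auto simp: cycles_2_6_def intro!: exI[of _ 1])
  then show ?thesis using False by simp
qed

end
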